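(* Let $n_1,n_2\ge 1$ be integers, and let $Y(1;1),\dots,Y(n_1;1)$ and $Y(1;2),\dots,Y(n_2;2)$ be two samples of real numbers. Put $n=n_1+n_2$ and $\tau_k=n_k/n$ for $k=1,2$. Let $M_k$ and $V_k$ be the sample mean and sample variance of the $k$-th sample, let $M$ and $V$ be the sample mean and sample variance of the combined sample of size $n$ consisting of all the observations of both samples, and let $V_{\mathrm{pool}}=\tau_1V_1+\tau_2V_2$. Then $$M=\tau_1M_1+\tau_2M_2=M_1+\tau_2(M_2-M_1),$$ $$V=V_{\mathrm{pool}}+\tau_1\tau_2\,(M_2-M_1)^2.$$
   Context: Sample mean and sample variance are unadjusted (divisor equal to the sample size): for a sample $y_1,\dots,y_m$ of real numbers, the sample mean is $\frac1m\sum_{t=1}^m y_t$, and the sample variance is $\frac1m\sum_{t=1}^m\big(y_t-\frac1m\sum_{s=1}^m y_s\big)^2$. Thus $M_k=\frac1{n_k}\sum_{t=1}^{n_k}Y(t;k)$, $V_k=\frac1{n_k}\sum_{t=1}^{n_k}(Y(t;k)-M_k)^2$, $M=\frac1n\sum_{k=1}^2\sum_{t=1}^{n_k}Y(t;k)$, and $V=\frac1n\sum_{k=1}^2\sum_{t=1}^{n_k}(Y(t;k)-M)^2$. *)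

theory Defs
  imports "HOL-Analysis.Analysis"
begin

text \<open>A sample is a family of real numbers indexed by a finite set \<open>I\<close>; the sample
  \<open>y 1, \<dots>, y m\<close> is the case \<open>I = {1..m}\<close>. Mean and variance are unadjusted.\<close>

definition sample_mean :: "'i set \<Rightarrow> ('i \<Rightarrow> real) \<Rightarrow> real" where
  "sample_mean I y = 1 / real (card I) * (\<Sum>t\<in>I. y t)"

definition sample_variance :: "'i set \<Rightarrow> ('i \<Rightarrow> real) \<Rightarrow> real" where
  "sample_variance I y = 1 / real (card I) * (\<Sum>t\<in>I. (y t - sample_mean I y)\<^sup>2)"

text \<open>In a family of samples, \<open>Y t k\<close> is the \<open>t\<close>-th observation of the \<open>k\<close>-th sample and
  \<open>n k\<close> is the size of the \<open>k\<close>-th sample. Indexing the combined sample by the pairs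
  \<open>(k, t)\<close> counts every observation, with repeated values kept.\<close>

definition combined_index :: "(nat \<Rightarrow> nat) \<Rightarrow> (nat \<times> nat) set" where
  "combined_index n = (SIGMA k:{1..2}. {1..n k})"

definition combined_sample :: "(nat \<Rightarrow> nat \<Rightarrow> real) \<Rightarrow> nat \<times> nat \<Rightarrow> real" where
  "combined_sample Y = (\<lambda>(k, t). Y t k)"

lemma card_combined_index: "card (combined_index n) = n 1 + n 2"
  by (simp add: combined_index_def numeral_2_eq_2)

lemma sample_mean_combined:
  "sample_mean (combined_index n) (combined_sample Y) =
     1 / real (n 1 + n 2) * (\<Sum>k=1..2. \<Sum>t=1..n k. Y t k)"
  unfolding sample_mean_def card_combined_index
  by (simp add: combined_index_def combined_sample_def sum.Sigma)

lemma sample_variance_combined: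
  "sample_variance (combined_index n) (combined_sample Y) =
     1 / real (n 1 + n 2) * (\<Sum>k=1..2. \<Sum>t=1..n k.
       (Y t k - sample_mean (combined_index n) (combined_sample Y))\<^sup>2)"
  unfolding sample_variance_def card_combined_index
  by (simp add: combined_index_def combined_sample_def sum.Sigma split_def)

end

theory Submission
  imports Defs
begin

text \<open>The variance identity is the parallel axis theorem applied to each sample about the
  combined mean: moving the reference point of a sum of squares from the mean of a sample to
  an arbitrary \<open>c\<close> costs the sample size times the squared distance from the mean to \<open>c\<close>,
  because the cross term is a multiple of the vanishing sum of deviations from the mean
  (lemma \<open>sum_sq_deviation_about\<close>). The combined mean divides the segment from \<open>M\<^sub>1\<close> to \<open>M\<^sub>2\<close>
  in the ratio \<open>\<tau>\<^sub>2 : \<tau>\<^sub>1\<close>, so with \<open>D = M\<^sub>2 - M\<^sub>1\<close> the two displacements are \<open>- \<tau>\<^sub>2 D\<close> and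
  \<open>\<tau>\<^sub>1 D\<close>, and the extra variance is
  \<open>\<tau>\<^sub>1 \<tau>\<^sub>2\<^sup>2 D\<^sup>2 + \<tau>\<^sub>2 \<tau>\<^sub>1\<^sup>2 D\<^sup>2 = \<tau>\<^sub>1 \<tau>\<^sub>2 D\<^sup>2\<close>.\<close>

text \<open>For an infinite or empty index set both sides are 0.\<close>

lemma card_mult_sample_mean: "real (card I) * sample_mean I y = (\<Sum>t\<in>I. y t)"
  by (cases "finite I \<and> I \<noteq> {}") (auto simp: sample_mean_def)

lemma card_mult_sample_variance:
  "real (card I) * sample_variance I y = (\<Sum>t\<in>I. (y t - sample_mean I y)\<^sup>2)"
  by (cases "finite I \<and> I \<noteq> {}") (auto simp: sample_variance_def)

text \<open>Expanding the square about the sample mean leaves no cross term, since the deviations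
  from the mean sum to 0.\<close>

lemma sum_sq_deviation_about:
  "(\<Sum>t\<in>I. (y t - c)\<^sup>2) =
     real (card I) * (sample_variance I y + (sample_mean I y - c)\<^sup>2)"
proof -
  let ?m = "sample_mean I y"
  have dev: "(\<Sum>t\<in>I. y t - ?m) = 0"
    by (simp add: sum_subtractf card_mult_sample_mean)
  have "(\<Sum>t\<in>I. (y t - c)\<^sup>2) =
      (\<Sum>t\<in>I. (y t - ?m)\<^sup>2 + 2 * (?m - c) * (y t - ?m) + (?m - c)\<^sup>2)"
    by (intro sum.cong refl) (simp add: power2_eq_square algebra_simps)
  also have "\<dots> = (\<Sum>t\<in>I. (y t - ?m)\<^sup>2) + 2 * (?m - c) * (\<Sum>t\<in>I. y t - ?m)
      + real (card I) * (?m - c)\<^sup>2"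
    by (simp add: sum.distrib sum_distrib_left)
  finally show ?thesis
    by (simp add: dev card_mult_sample_variance distrib_left)
qed

theorem mainTheorem2:
  fixes n :: "nat \<Rightarrow> nat" and Y :: "nat \<Rightarrow> nat \<Rightarrow> real"
  assumes "n 1 \<ge> 1" and "n 2 \<ge> 1"
  defines "N \<equiv> n 1 + n 2"
  defines "\<tau> \<equiv> \<lambda>k. real (n k) / real N"
  defines "Mk \<equiv> \<lambda>k. sample_mean {1..n k} (\<lambda>t. Y t k)"
  defines "Vk \<equiv> \<lambda>k. sample_variance {1..n k} (\<lambda>t. Y t k)"
  defines "M \<equiv> sample_mean (combined_index n) (combined_sample Y)"
  defines "V \<equiv> sample_variance (combined_index n) (combined_sample Y)"
  defines "Vpool \<equiv> \<tau> 1 * Vk 1 + \<tau> 2 * Vk 2"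
  shows "M = \<tau> 1 * Mk 1 + \<tau> 2 * Mk 2 \<and>
         \<tau> 1 * Mk 1 + \<tau> 2 * Mk 2 = Mk 1 + \<tau> 2 * (Mk 2 - Mk 1) \<and>
         V = Vpool + \<tau> 1 * \<tau> 2 * (Mk 2 - Mk 1)\<^sup>2"
proof -
  have N: "real N > 0"
    using assms(1) by (simp add: N_def)
  have two: "(\<Sum>k=1..2. f k) = f 1 + f 2" for f :: "nat \<Rightarrow> real"
    by (simp add: numeral_2_eq_2)
  have weights: "\<tau> 1 + \<tau> 2 = 1"
    using N by (simp add: \<tau>_def N_def add_divide_distrib [symmetric])
  have sums: "(\<Sum>t=1..n k. Y t k) = real (n k) * Mk k" for k
    using card_mult_sample_mean [of "{1..n k}" "\<lambda>t. Y t k"] by (simp add: Mk_def)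
  have mean: "M = \<tau> 1 * Mk 1 + \<tau> 2 * Mk 2"
    unfolding M_def sample_mean_combined two sums
    by (simp add: \<tau>_def N_def add_divide_distrib)
  have \<tau>1: "\<tau> 1 = 1 - \<tau> 2"
    using weights by simp
  have convex: "\<tau> 1 * Mk 1 + \<tau> 2 * Mk 2 = Mk 1 + \<tau> 2 * (Mk 2 - Mk 1)"
    unfolding \<tau>1 by (simp add: algebra_simps)
  have squares: "(\<Sum>t=1..n k. (Y t k - M)\<^sup>2) = real (n k) * (Vk k + (Mk k - M)\<^sup>2)" for k
    using sum_sq_deviation_about [of "\<lambda>t. Y t k" M "{1..n k}"] by (simp add: Vk_def Mk_def)
  have "V = \<tau> 1 * (Vk 1 + (Mk 1 - M)\<^sup>2) + \<tau> 2 * (Vk 2 + (Mk 2 - M)\<^sup>2)"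
    unfolding V_def sample_variance_combined M_def [symmetric] two squares
    by (simp add: \<tau>_def N_def add_divide_distrib)
  also have "\<dots> = Vpool + \<tau> 1 * \<tau> 2 * (Mk 2 - Mk 1)\<^sup>2"
    unfolding Vpool_def mean \<tau>1 by (simp add: power2_eq_square algebra_simps)
  finally show ?thesis
    using mean convex by simp
qed

end
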